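(* Fix a group $k$. Assume the EV charging queue $J_{k,t}$ and the delay-aware virtual queue $H_{k,t}$ evolve according to $$J_{k,t+1}=\max[J_{k,t}-\check p_{k,t},0]+a_{k,t},$$ $$H_{k,t+1}=\begin{cases}\max\left[H_{k,t}+\frac{\lambda}{R_k}-\check p_{k,t},\,0\right], & \text{if } J_{k,t}>\check p_{k,t},\\ 0, & \text{otherwise,}\end{cases}$$ and that an algorithm (a choice of the $\check p_{k,t}$) ensures $J_{k,t}\le J_{k,max}$ and $H_{k,t}\le H_{k,max}$ for all time slots $t\in\mathcal T$, where $J_{k,max}$ and $H_{k,max}$ are finite constants. Suppose EV charging tasks are serviced in a first-in-first-out (FIFO) order. Then the worst-case delay of all EV charging tasks in queue $k$ is bounded by $$\delta_{k,max}=\frac{(J_{k,max}+H_{k,max})R_k}{\lambda}.$$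
   Context: Time slots are $t\in\mathcal T=\{1,\dots,T\}$. For group $k$ of electric vehicles (EVs), $J_{k,t}\ge 0$ is the backlog of charging tasks at slot $t$, $\check p_{k,t}\ge 0$ is the amount of charging tasks the queue can process in slot $t$, and $a_{k,t}\ge 0$ is the amount of new charging tasks arriving during slot $t$. Tasks $a_{k,t}$ arriving in slot $t$ are appended at the end of the backlog $J_{k,t+1}$ and are first available for processing in slot $t+1$. $H_{k,t}$ is a virtual queue with $H_{k,1}=0$; $\lambda>0$ is a given parameter and $R_k>0$ is the charging duration of group $k$. "The worst-case delay is bounded by $\delta_{k,max}$" means that, for every slot $t$, all of the charging tasks $a_{k,t}$ that arrive in slot $t$ are finished (fully processed) at or before time slot $t+\delta_{k,max}$.
   Formalization: Read with a non-integer delay bound rounded up (tasks finished by the first slot at or after t+δ_max), and only for deadlines strictly before the final slot T; the literal claim fails for non-integer δ_max and at a deadline equal to T. *)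

theory Defs
  imports Complex_Main
begin

text \<open>A backlog is a list of batches \<open>(u, w)\<close>, oldest batch at the head: \<open>u\<close> is the slot in which
  the batch arrived and \<open>w\<close> is the amount of its tasks that is still unprocessed. The tasks are
  divisible, so a batch can be processed partially.\<close>

fun fifo_serve :: "real \<Rightarrow> (nat \<times> real) list \<Rightarrow> (nat \<times> real) list" where
  "fifo_serve c [] = []"
| "fifo_serve c ((u, w) # q) = (if w \<le> c then fifo_serve (c - w) q else (u, w - c) # q)"

text \<open>The backlog at the beginning of a slot. Slots are numbered from 1, so the value at 0 is
  irrelevant. The initial backlog \<open>J1\<close>, whose arrival slot is not specified, carries the label 0.
  The tasks arriving in slot \<open>s\<close> are appended after the service of slot \<open>s\<close>, hence they can be
  processed from slot \<open>s + 1\<close> on.\<close>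

fun fifo_backlog :: "real \<Rightarrow> (nat \<Rightarrow> real) \<Rightarrow> (nat \<Rightarrow> real) \<Rightarrow> nat \<Rightarrow> (nat \<times> real) list" where
  "fifo_backlog J1 p a 0 = []"
| "fifo_backlog J1 p a (Suc 0) = [(0, J1)]"
| "fifo_backlog J1 p a (Suc (Suc n)) =
     fifo_serve (p (Suc n)) (fifo_backlog J1 p a (Suc n)) @ [(Suc n, a (Suc n))]"

text \<open>All tasks arriving in slot \<open>t\<close> are finished at or before slot \<open>s\<close>: nothing of them is left
  after the service of slot \<open>s\<close>, that is, at the beginning of slot \<open>s + 1\<close>.\<close>

definition finished_by :: "real \<Rightarrow> (nat \<Rightarrow> real) \<Rightarrow> (nat \<Rightarrow> real) \<Rightarrow> nat \<Rightarrow> nat \<Rightarrow> bool" where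
  "finished_by J1 p a t s \<longleftrightarrow>
     t \<le> s \<and> (\<forall>w. (t, w) \<in> set (fifo_backlog J1 p a (Suc s)) \<longrightarrow> w = 0)"

text \<open>The bound \<open>\<delta>\<close> is real, so \<open>t + \<delta>\<close> need not be a slot; the deadline is then the first slot
  \<open>s \<ge> t + \<delta>\<close> (rounding down would demand service in the arrival slot whenever \<open>\<delta> < 1\<close>).
  The horizon is finite: completion in slot \<open>s\<close> shows in the state at the beginning of
  slot \<open>s + 1\<close>, which has to lie within the horizon \<open>{1..T}\<close>.\<close>

definition worst_case_delay_bounded ::
    "nat \<Rightarrow> real \<Rightarrow> (nat \<Rightarrow> real) \<Rightarrow> (nat \<Rightarrow> real) \<Rightarrow> real \<Rightarrow> bool" where
  "worst_case_delay_bounded T J1 p a \<delta> \<longleftrightarrow>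
     (\<forall>t\<in>{1..T}. \<forall>s. real t + \<delta> \<le> real s \<and> s + 1 \<in> {1..T} \<longrightarrow> finished_by J1 p a t s)"

end

theory Submission imports Defs begin

text \<open>Suppose part of the tasks of slot \<open>t\<close> is still waiting after the service of slot \<open>s\<close>. By FIFO,
  the tasks that were in the queue at the beginning of slot \<open>t + 1\<close> have absorbed all the service of
  the slots \<open>t + 1, \<dots>, s\<close>, so this service is less than \<open>J (t + 1) \<le> Jmax\<close>. In all these slots the
  queue is not emptied, so the virtual queue grows by at least \<open>lam / R\<close> minus the service in each
  of them; since it stays below \<open>Hmax\<close>, we get \<open>(s - t) * lam / R < Jmax + Hmax\<close>.\<close>

text \<open>Under FIFO, later arrivals cannot delay the tasks counted here, so from slot
  \<open>t + 1\<close> on this quantity behaves like a queue without arrivals. The initial backlog,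
  labelled 0, is always counted.\<close>

definition work_upto :: "nat \<Rightarrow> (nat \<times> real) list \<Rightarrow> real" where
  "work_upto t q = (\<Sum>b\<leftarrow>filter (\<lambda>b. fst b \<le> t) q. snd b)"

text \<open>The invariant of backlogs. Sorted labels make the batches up to any \<open>t\<close> a
  prefix of the list, the part served first.\<close>

definition fifo_queue :: "(nat \<times> real) list \<Rightarrow> bool" where
  "fifo_queue q \<longleftrightarrow> sorted (map fst q) \<and> (\<forall>b\<in>set q. 0 \<le> snd b)"

lemma work_upto_Nil [simp]: "work_upto t [] = 0"
  by (simp add: work_upto_def)

lemma work_upto_Cons [simp]:
  "work_upto t (b # q) = (if fst b \<le> t then snd b else 0) + work_upto t q"
  by (simp add: work_upto_def)

lemma work_upto_append [simp]: "work_upto t (q @ r) = work_upto t q + work_upto t r"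
  by (simp add: work_upto_def)

lemma fifo_queue_Cons:
  "fifo_queue (b # q) \<longleftrightarrow> (\<forall>b'\<in>set q. fst b \<le> fst b') \<and> 0 \<le> snd b \<and> fifo_queue q"
  by (auto simp: fifo_queue_def)

lemma work_upto_nonneg: "fifo_queue q \<Longrightarrow> 0 \<le> work_upto t q"
  by (induction q) (auto simp: fifo_queue_Cons)

lemma le_work_upto:
  assumes "fifo_queue q" "(t, w) \<in> set q"
  shows "w \<le> work_upto t q"
  using assms
proof (induction q)
  case (Cons b q)
  then show ?case
    using work_upto_nonneg[of q t] by (fastforce simp: fifo_queue_Cons)
qed simp

lemma work_upto_eq_0: "\<forall>b\<in>set q. t < fst b \<Longrightarrow> work_upto t q = 0"
  by (induction q) auto

lemma fst_set_fifo_serve: "fst ` set (fifo_serve c q) \<subseteq> fst ` set q"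
  by (induction c q rule: fifo_serve.induct) auto

lemma fifo_queue_fifo_serve: "fifo_queue q \<Longrightarrow> fifo_queue (fifo_serve c q)"
  by (induction c q rule: fifo_serve.induct) (auto simp: fifo_queue_Cons)

text \<open>Service consumes the list from the head, and the counted batches form a prefix, so no
  capacity goes to later batches while counted work remains.\<close>

lemma work_upto_fifo_serve:
  assumes "fifo_queue q"
  shows "work_upto t (fifo_serve c q) \<le> max (work_upto t q - c) 0"
  using assms
proof (induction c q rule: fifo_serve.induct)
  case (2 c u w q)
  show ?case
  proof (cases "u \<le> t")
    case True
    with 2 show ?thesis by (auto simp: fifo_queue_Cons algebra_simps)
  next
    case False
    \<comment> \<open>A head later than \<open>t\<close> means that the counted prefix is empty;
      service adds no labels, so it stays empty.\<close>
    have "\<forall>b\<in>set ((u, w) # q). t < fst b"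
      using False 2(2) by (auto simp: fifo_queue_Cons)
    moreover from this have "\<forall>b\<in>set (fifo_serve c ((u, w) # q)). t < fst b"
      using fst_set_fifo_serve[of c "(u, w) # q"] by (fastforce simp del: fifo_serve.simps)
    ultimately show ?thesis by (metis max.cobounded2 work_upto_eq_0)
  qed
qed simp

lemma fifo_backlog_Suc:
  "1 \<le> n \<Longrightarrow> fifo_backlog J1 p a (Suc n) = fifo_serve (p n) (fifo_backlog J1 p a n) @ [(n, a n)]"
  by (cases n) auto

lemma fst_fifo_backlog_less: "b \<in> set (fifo_backlog J1 p a n) \<Longrightarrow> fst b < n"
proof (induction n arbitrary: b)
  case (Suc n)
  show ?case
  proof (cases "n = 0")
    case False
    then have "b \<in> set (fifo_serve (p n) (fifo_backlog J1 p a n)) \<or> b = (n, a n)"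
      using Suc.prems by (auto simp: fifo_backlog_Suc)
    then show ?thesis
      using Suc.IH fst_set_fifo_serve[of "p n" "fifo_backlog J1 p a n"]
      by (fastforce intro: less_SucI)
  qed (use Suc.prems in auto)
qed simp

lemma fifo_queue_fifo_backlog:
  assumes "0 \<le> J1" "\<And>i. 1 \<le> i \<Longrightarrow> i < n \<Longrightarrow> 0 \<le> a i"
  shows "fifo_queue (fifo_backlog J1 p a n)"
  using assms(2)
proof (induction n)
  case 0
  show ?case by (simp add: fifo_queue_def)
next
  case (Suc n)
  show ?case
  proof (cases "n = 0")
    case True
    then show ?thesis using assms(1) by (simp add: fifo_queue_def)
  next
    case False
    have "fifo_queue (fifo_serve (p n) (fifo_backlog J1 p a n))"
      using Suc by (simp add: fifo_queue_fifo_serve)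
    moreover have "\<forall>b\<in>set (fifo_serve (p n) (fifo_backlog J1 p a n)). fst b \<le> n"
      using fst_set_fifo_serve[of "p n" "fifo_backlog J1 p a n"] fst_fifo_backlog_less[of _ J1 p a n]
      by fastforce
    ultimately show ?thesis
      using False Suc.prems by (auto simp: fifo_backlog_Suc fifo_queue_def sorted_append)
  qed
qed

text \<open>Ties the list model to \<open>J\<close>: service obeys the same \<open>max\<close>
  recursion, and the arriving batch adds at most \<open>a n\<close> to the counted work.\<close>

lemma work_upto_fifo_backlog_le:
  assumes "\<And>i. 1 \<le> i \<Longrightarrow> i < n \<Longrightarrow> 0 \<le> a i" "0 \<le> J 1" "1 \<le> n"
    and "\<And>i. 1 \<le> i \<Longrightarrow> i < n \<Longrightarrow> J (Suc i) = max (J i - p i) 0 + a i"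
  shows "work_upto t (fifo_backlog (J 1) p a n) \<le> J n"
  using assms(3,1,4)
proof (induction n rule: nat_induct_at_least)
  case base
  then show ?case using assms(2) by simp
next
  case (Suc n)
  let ?q = "fifo_backlog (J 1) p a n"
  have "work_upto t (fifo_serve (p n) ?q) \<le> max (work_upto t ?q - p n) 0"
    using Suc.prems assms(2) by (intro work_upto_fifo_serve fifo_queue_fifo_backlog) auto
  moreover have "work_upto t ?q \<le> J n" using Suc by simp
  moreover have "0 \<le> a n" "J (Suc n) = max (J n - p n) 0 + a n" using Suc by simp_all
  ultimately show ?case using Suc.hyps by (auto simp: fifo_backlog_Suc)
qed

text \<open>Batches appended in slots after \<open>t\<close> have labels above \<open>t\<close> and
  add nothing. As \<open>p\<close> is nonnegative, the truncations at 0 of the single slots merge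
  into one.\<close>

lemma work_upto_fifo_backlog_decreases:
  assumes "\<And>i. 1 \<le> i \<Longrightarrow> i < n \<Longrightarrow> 0 \<le> a i" "\<And>i. 1 \<le> i \<Longrightarrow> i < n \<Longrightarrow> 0 \<le> p i"
    and "0 \<le> J1" "Suc t \<le> n"
  shows "work_upto t (fifo_backlog J1 p a n)
    \<le> max (work_upto t (fifo_backlog J1 p a (Suc t)) - sum p {Suc t..<n}) 0"
  using assms(4,1,2)
proof (induction n rule: nat_induct_at_least)
  case (Suc n)
  let ?q = "fifo_backlog J1 p a n"
  have "work_upto t (fifo_serve (p n) ?q) \<le> max (work_upto t ?q - p n) 0"
    using Suc.prems assms(3) by (intro work_upto_fifo_serve fifo_queue_fifo_backlog) auto
  moreover have "work_upto t ?q
      \<le> max (work_upto t (fifo_backlog J1 p a (Suc t)) - sum p {Suc t..<n}) 0"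
    using Suc by simp
  moreover have "0 \<le> p n" using Suc by simp
  ultimately show ?case using Suc.hyps by (auto simp: fifo_backlog_Suc)
qed simp

lemma initial_minus_sum_le:
  fixes J p :: "nat \<Rightarrow> real"
  assumes "m \<le> n" "\<And>i. m \<le> i \<Longrightarrow> i < n \<Longrightarrow> J i - p i \<le> J (Suc i)"
  shows "J m - sum p {m..<n} \<le> J n"
  using assms
proof (induction n rule: nat_induct_at_least)
  case (Suc n)
  then have "J m - sum p {m..<n} \<le> J n" "J n - p n \<le> J (Suc n)" by simp_all
  then show ?case using Suc.hyps by simp
qed simp

lemma virtual_queue_growth:
  fixes H p :: "nat \<Rightarrow> real"
  assumes "m \<le> n" "\<And>i. m \<le> i \<Longrightarrow> i < n \<Longrightarrow> H i + g - p i \<le> H (Suc i)"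
  shows "H m + real (n - m) * g - sum p {m..<n} \<le> H n"
  \<comment> \<open>The growth \<open>g\<close> is treated as negative service.\<close>
  using initial_minus_sum_le[of m n H "\<lambda>i. p i - g"] assms
  by (simp add: sum_subtractf algebra_simps)

theorem lemma1:
  fixes T :: nat and J H p a :: "nat \<Rightarrow> real" and lam R Jmax Hmax :: real
  assumes "lam > 0" and "R > 0"
    and "\<And>t. t \<in> {1..T} \<Longrightarrow> J t \<ge> 0"
    and "\<And>t. t \<in> {1..T} \<Longrightarrow> p t \<ge> 0"
    and "\<And>t. t \<in> {1..T} \<Longrightarrow> a t \<ge> 0"
    and "H 1 = 0"
    and "\<And>t. t \<in> {1..T} \<Longrightarrow> J (t + 1) = max (J t - p t) 0 + a t"
    and "\<And>t. t \<in> {1..T} \<Longrightarrow>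
           H (t + 1) = (if J t > p t then max (H t + lam / R - p t) 0 else 0)"
    and "\<And>t. t \<in> {1..T} \<Longrightarrow> J t \<le> Jmax"
    and "\<And>t. t \<in> {1..T} \<Longrightarrow> H t \<le> Hmax"
  shows "worst_case_delay_bounded T (J 1) p a ((Jmax + Hmax) * R / lam)"
proof -
  note lam = assms(1) and R = assms(2) and J_nonneg = assms(3) and p_nonneg = assms(4)
    and a_nonneg = assms(5) and H1 = assms(6) and J_step = assms(7) and H_step = assms(8)
    and J_le = assms(9) and H_le = assms(10)
  have "finished_by (J 1) p a t s"
    if t: "t \<in> {1..T}" and deadline: "real t + (Jmax + Hmax) * R / lam \<le> real s"
      and s: "s + 1 \<in> {1..T}" for t s
    unfolding finished_by_def
  proof (intro conjI allI impI)
    have one: "1 \<in> {1..T}" using t by auto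
    \<comment> \<open>Slot 1 witnesses this, since \<open>J 1\<close> is nonnegative and
      \<open>H 1 = 0\<close>; hence the deadline does not precede \<open>t\<close>.\<close>
    have "0 \<le> Jmax + Hmax"
      using J_nonneg[OF one] J_le[OF one] H_le[OF one] H1 by linarith
    then have "0 \<le> (Jmax + Hmax) * R / lam" using lam R by simp
    then show ts: "t \<le> s" using deadline by linarith
    fix w
    assume w: "(t, w) \<in> set (fifo_backlog (J 1) p a (Suc s))"
    have queue: "fifo_queue (fifo_backlog (J 1) p a (Suc s))"
      using s J_nonneg[OF one] a_nonneg by (intro fifo_queue_fifo_backlog) auto
    show "w = 0"
    proof (rule ccontr)
      assume "w \<noteq> 0"
      moreover have "0 \<le> w" using queue w by (auto simp: fifo_queue_def)
      ultimately have "0 < work_upto t (fifo_backlog (J 1) p a (Suc s))"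
        using le_work_upto[OF queue w] by linarith
      moreover have "work_upto t (fifo_backlog (J 1) p a (Suc s))
          \<le> max (work_upto t (fifo_backlog (J 1) p a (Suc t)) - sum p {Suc t..<Suc s}) 0"
        using s ts J_nonneg[OF one] a_nonneg p_nonneg
        by (intro work_upto_fifo_backlog_decreases) auto
      moreover have "work_upto t (fifo_backlog (J 1) p a (Suc t)) \<le> J (Suc t)"
        using s t ts J_nonneg[OF one] a_nonneg J_step
        by (intro work_upto_fifo_backlog_le) auto
      \<comment> \<open>The remaining work is positive, so the \<open>max\<close> is not attained by
        0.\<close>
      ultimately have served: "sum p {Suc t..<Suc s} < J (Suc t)" by linarith
      \<comment> \<open>The backlog at \<open>i\<close> is at least \<open>J (Suc t)\<close> minus
        the service before \<open>i\<close>. By \<open>served\<close>, this exceeds the service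
        still to come up to slot \<open>s\<close>, which includes \<open>p i\<close>. So
        \<open>H\<close> is never reset in these slots.\<close>
      have busy: "p i < J i" if "Suc t \<le> i" "i < Suc s" for i
      proof -
        have "J (Suc t) - sum p {Suc t..<i} \<le> J i"
        proof (rule initial_minus_sum_le[OF that(1)])
          fix j assume "Suc t \<le> j" "j < i"
          then have "j \<in> {1..T}" using that s by auto
          then show "J j - p j \<le> J (Suc j)" using J_step[of j] a_nonneg[of j] by simp
        qed
        moreover have "sum p {Suc t..<Suc i} \<le> sum p {Suc t..<Suc s}"
          using that s p_nonneg by (intro sum_mono2) auto
        ultimately show ?thesis using served that by simp
      qed
      have "H (Suc t) + real (Suc s - Suc t) * (lam / R) - sum p {Suc t..<Suc s} \<le> H (Suc s)"
      proof (rule virtual_queue_growth)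
        fix i assume i: "Suc t \<le> i" "i < Suc s"
        then have "i \<in> {1..T}" using s by auto
        then show "H i + lam / R - p i \<le> H (Suc i)" using H_step[of i] busy[OF i] by simp
      qed (use ts in simp)
      \<comment> \<open>Both branches of the recursion yield a nonnegative value.\<close>
      moreover have "0 \<le> H (Suc t)" using H_step[OF t] by simp
      moreover have "H (Suc s) \<le> Hmax" "J (Suc t) \<le> Jmax"
        using H_le[of "Suc s"] J_le[of "Suc t"] s ts by auto
      ultimately have "(real s - real t) * (lam / R) < Jmax + Hmax"
        using served ts by (simp add: of_nat_diff)
      then have "real s - real t < (Jmax + Hmax) * R / lam"
        using lam R by (simp add: field_simps)
      then show False using deadline by linarith
    qed
  qed
  then show ?thesis by (auto simp: worst_case_delay_bounded_def)
qed

end
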